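(* Let $S$ be the sum of $n$ independent (not necessarily identically distributed) Bernoulli random variables. For any positive integer $k\le \mathbb{E}[S]$, letting $\gamma=\mathbb{E}[S]/k\ge 1$, we have \[\Pr[S<k]\le e^{-\gamma}\,(e/2)^{e^{1-\gamma}}.\] *)

theory Defs
  imports "HOL-Probability.Probability"
begin

definition bernoulli_rv :: "'a measure \<Rightarrow> ('a \<Rightarrow> real) \<Rightarrow> real \<Rightarrow> bool" where
  "bernoulli_rv M X p \<longleftrightarrow>
     0 \<le> p \<and> p \<le> 1 \<and> X \<in> borel_measurable M \<and>
     distr M borel X = distr (measure_pmf (bernoulli_pmf p)) borel (of_bool :: bool \<Rightarrow> real)"

end

theory Submission
  imports Defs "HOL-Computational_Algebra.Polynomial"
begin

text \<open>
  The proof reduces to the binomial case by Hoeffding's exchange argument. For fixed \<open>x + y\<close>, the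
  probability \<open>Pr[S < k]\<close> is an affine function of the product \<open>x y\<close> of two success probabilities
  \<open>x < a < y\<close>, where \<open>a\<close> is the mean of all of them. If the slope is nonnegative, replace the pair by
  \<open>a, x + y - a\<close>; otherwise push one member of the pair to 0 or 1 and drop it. Dropping a 1 lowers
  both \<open>E[S]\<close> and \<open>k\<close> by one, which can only increase \<open>\<gamma>\<close>, and the bound is decreasing in \<open>\<gamma>\<close>.
  The process ends with all probabilities equal.

  For \<open>Bin(r, a)\<close> with \<open>k \<ge> 2\<close>, let \<open>F(a) = Pr[Bin(r, a) < k]\<close>. Comparing consecutive terms shows that
  the logarithmic derivative of \<open>F\<close> with respect to \<open>\<gamma> = r a / k \<ge> 1\<close> is at most \<open>- 4/3\<close>. At \<open>a = k / r\<close>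
  one has \<open>F(a) \<le> 1/2\<close>: the function \<open>F(a t) + F(a / t)\<close> is increasing for \<open>t\<close> between 1 and
  \<open>1 / a\<close>, and at the right endpoint it is at most 1. Since \<open>1 - ln 2 \<le> 1/3\<close>, the
  resulting estimate \<open>exp (- 4/3 (\<gamma> - 1)) / 2\<close> is below the claimed bound.
\<close>

subsection \<open>Lower tails of binomial distributions\<close>

text \<open>The derivative of one Bernstein polynomial is \<open>Suc m\<close> times a difference of
  two neighbours of degree \<open>m\<close>, so the sum telescopes.\<close>

lemma has_real_derivative_sum_Bernstein:
  "((\<lambda>x. \<Sum>j\<le>k. Bernstein (Suc m) j x) has_real_derivative - real (Suc m) * Bernstein m k x) (at x)"
proof (induction k)
  case 0
  have "((\<lambda>x. (1 - x) ^ Suc m) has_real_derivative - real (Suc m) * (1 - x) ^ m) (at x)"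
    by (rule derivative_eq_intros refl | simp)+ (simp add: algebra_simps)
  then show ?case by (simp add: Bernstein_def)
next
  case (Suc k)
  let ?C = "real (Suc m choose Suc k)"
  have 1: "?C * real (Suc k) = real (Suc m) * real (m choose k)"
    using binomial_absorption[of k "Suc m"] by (metis diff_Suc_1 mult.commute of_nat_mult)
  have 2: "?C * real (m - k) = real (Suc m) * real (m choose Suc k)"
    using binomial_absorb_comp[of "Suc m" "Suc k"]
    by (metis diff_Suc_1 diff_Suc_Suc mult.commute of_nat_mult)
  have "((\<lambda>x. Bernstein (Suc m) (Suc k) x) has_real_derivative
      (?C * real (Suc k)) * x ^ k * (1 - x) ^ (m - k)
       - (?C * real (m - k)) * x ^ Suc k * (1 - x) ^ (m - Suc k)) (at x)"
    unfolding Bernstein_def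
    by (rule derivative_eq_intros refl | simp add: algebra_simps)+
  then have "((\<lambda>x. Bernstein (Suc m) (Suc k) x) has_real_derivative
      real (Suc m) * Bernstein m k x - real (Suc m) * Bernstein m (Suc k) x) (at x)"
    unfolding 1 2 by (simp add: Bernstein_def mult.assoc)
  from DERIV_add[OF Suc this] show ?case
    by (simp add: algebra_simps)
qed

text \<open>This turns \<open>x\<close> times the derivative of the tail into a single term of the
  same degree as the tail.\<close>

lemma Bernstein_absorb: "x * real (Suc m) * Bernstein m k x = real (Suc k) * Bernstein (Suc m) (Suc k) x"
proof -
  have "real (Suc k) * real (Suc m choose Suc k) = real (Suc m) * real (m choose k)"
    using binomial_absorption[of k "Suc m"] by (metis diff_Suc_1 of_nat_mult)
  then show ?thesis
    unfolding Bernstein_def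
    by (simp only: power_Suc diff_Suc_Suc) (metis (no_types, opaque_lifting) mult.assoc mult.commute)
qed

section \<open>Growth of the binomial terms below the mean\<close>

lemma Bernstein_ratio:
  assumes "i < r"
  shows "real (r - i) * x * Bernstein r i x = real (Suc i) * (1 - x) * Bernstein r (Suc i) x"
proof -
  have c: "real (Suc i) * real (r choose Suc i) = real (r - i) * real (r choose i)"
    using binomial_absorption[of i r] binomial_absorb_comp[of r i] by (metis of_nat_mult)
  have p: "(1 - x) ^ (r - i) = (1 - x) * (1 - x) ^ (r - Suc i)"
    using assms by (metis Suc_diff_Suc power_Suc)
  have "real (r - i) * x * Bernstein r i x
      = (real (r - i) * real (r choose i)) * (x ^ Suc i * (1 - x) * (1 - x) ^ (r - Suc i))"
    by (simp add: Bernstein_def p)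
  also have "\<dots> = real (Suc i) * (1 - x) * Bernstein r (Suc i) x"
    unfolding c[symmetric] Bernstein_def by simp
  finally show ?thesis .
qed

text \<open>After multiplication by \<open>r - i\<close>, the exact ratio of neighbours leaves
  \<open>r * (1 - x) \<le> r - i\<close>, which holds because
  \<open>i < k \<le> r * x\<close>.\<close>

lemma Bernstein_step_below_mean:
  assumes "i < k" "real k \<le> real r * x" "0 \<le> x" "x \<le> 1"
  shows "real r * x * Bernstein r i x \<le> real (Suc i) * Bernstein r (Suc i) x"
proof -
  have "real r * x \<le> real r" using assms by (simp add: mult_left_le)
  then have ir: "i < r" "k \<le> r" using assms by linarith+
  have "real (r - i) * (real r * x * Bernstein r i x)
      = real r * (1 - x) * (real (Suc i) * Bernstein r (Suc i) x)"
    using arg_cong[OF Bernstein_ratio[OF ir(1), of x], of "(*) (real r)"] by (simp only: mult_ac)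
  also have "\<dots> \<le> real (r - i) * (real (Suc i) * Bernstein r (Suc i) x)"
    using assms ir by (intro mult_right_mono) (auto simp: Bernstein_nonneg algebra_simps of_nat_diff)
  finally show ?thesis using ir by (simp add: mult_le_cancel_left)
qed

lemma Bernstein_mono_below_mean:
  assumes "i \<le> k" "real k \<le> real r * x" "0 \<le> x" "x \<le> 1"
  shows "Bernstein r i x \<le> Bernstein r k x"
  using assms
proof (induction i rule: inc_induct)
  case (step i)
  have "real (Suc i) * Bernstein r i x \<le> real r * x * Bernstein r i x"
    using step by (intro mult_right_mono) (auto simp: Bernstein_nonneg)
  also have "\<dots> \<le> real (Suc i) * Bernstein r (Suc i) x"
    by (rule Bernstein_step_below_mean) (use step in auto)
  finally have "Bernstein r i x \<le> Bernstein r (Suc i) x"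
    by (simp add: mult_le_cancel_left)
  with step show ?case by simp
qed simp

text \<open>Each term moves up one index at the cost \<open>j + 1\<close>, then to index
  \<open>k\<close> by monotonicity; the costs add up to \<open>k * (k + 1) / 2\<close>.\<close>

lemma sum_Bernstein_below_mean:
  assumes "real k \<le> real r * x" "0 \<le> x" "x \<le> 1"
  shows "real r * x * (\<Sum>j<k. Bernstein r j x) \<le> real k * real (Suc k) / 2 * Bernstein r k x"
proof -
  have "real r * x * (\<Sum>j<k. Bernstein r j x) = (\<Sum>j<k. real r * x * Bernstein r j x)"
    by (simp add: sum_distrib_left)
  also have "\<dots> \<le> (\<Sum>j<k. real (Suc j) * Bernstein r k x)"
  proof (rule sum_mono)
    fix j assume "j \<in> {..<k}"
    then have j: "j < k" by simp
    have "real r * x * Bernstein r j x \<le> real (Suc j) * Bernstein r (Suc j) x"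
      using Bernstein_step_below_mean j assms by blast
    also have "\<dots> \<le> real (Suc j) * Bernstein r k x"
      using Bernstein_mono_below_mean[of "Suc j" k] j assms by (intro mult_left_mono) auto
    finally show "real r * x * Bernstein r j x \<le> real (Suc j) * Bernstein r k x" .
  qed
  also have "\<dots> = (\<Sum>j<k. real (Suc j)) * Bernstein r k x"
    by (simp add: sum_distrib_right)
  also have "(\<Sum>j<k. real (Suc j)) = real k * real (Suc k) / 2"
    by (induction k) (auto simp: field_simps)
  finally show ?thesis .
qed

text \<open>The bound on the logarithmic derivative is used in the form that
  \<open>F x * exp (c * x)\<close> is nonincreasing, which avoids dividing by
  \<open>F\<close>.\<close>

lemma sum_Bernstein_exp_decay:
  assumes k: "2 \<le> k" and a: "real k \<le> real r * a" and ab: "a \<le> b" "0 \<le> a" "b \<le> 1"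
  shows "(\<Sum>j<k. Bernstein r j b) \<le> (\<Sum>j<k. Bernstein r j a) * exp (- (4/3) * (real r / real k) * (b - a))"
proof -
  define c where "c = 4/3 * (real r / real k)"
  define F where "F x = (\<Sum>j<k. Bernstein r j x)" for x
  have "r \<noteq> 0" using a k by (intro notI) simp
  obtain l m where kl: "k = Suc l" and rm: "r = Suc m"
    using k \<open>r \<noteq> 0\<close> not0_implies_Suc by (metis not_numeral_le_zero)
  have F': "(F has_real_derivative - real r * Bernstein m l x) (at x)" for x
    unfolding F_def kl rm lessThan_Suc_atMost by (rule has_real_derivative_sum_Bernstein)
  have "F b * exp (c * b) \<le> F a * exp (c * a)"
  proof (rule DERIV_nonpos_imp_nonincreasing[OF ab(1)])
    fix x assume x: "a \<le> x" "x \<le> b"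
    have x01: "0 \<le> x" "x \<le> 1" and kx: "real k \<le> real r * x"
      using x ab a order_trans[OF a mult_left_mono[OF x(1)]] by auto
    have "x > 0" using kx k x01 by (cases "x = 0") auto
    let ?D = "(- real r * Bernstein m l x) * exp (c * x) + (exp (c * x) * c) * F x"
    have "((\<lambda>x. F x * exp (c * x)) has_real_derivative ?D) (at x)"
      by (rule derivative_eq_intros F' refl | simp)+
    moreover have "?D \<le> 0"
    proof -
      have "real r * x * F x \<le> real k * real (Suc k) / 2 * Bernstein r k x"
        unfolding F_def by (rule sum_Bernstein_below_mean[OF kx x01])
      \<comment> \<open>The factor \<open>(k + 1) / 2\<close> is at most \<open>3/4 * k\<close>
        exactly when \<open>k \<ge> 2\<close>; this is the source of the rate 4/3.\<close>
      also have "\<dots> \<le> real k * (3 / 4 * (real k)) * Bernstein r k x"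
        using k by (intro mult_right_mono Bernstein_nonneg x01)
          (auto simp: field_simps)
      also have "\<dots> = 3/4 * real k * (x * real r * Bernstein m l x)"
        unfolding kl rm Bernstein_absorb by simp
      finally have "x * (real r * F x) \<le> x * (3/4 * real k * (real r * Bernstein m l x))"
        by (simp add: algebra_simps)
      then have "real r * F x \<le> 3/4 * real k * (real r * Bernstein m l x)"
        using \<open>x > 0\<close> by (simp add: mult_le_cancel_left)
      then have "c * F x \<le> real r * Bernstein m l x"
        using k by (simp add: c_def field_simps)
      then have "exp (c * x) * (c * F x - real r * Bernstein m l x) \<le> 0"
        by (simp add: mult_nonneg_nonpos)
      then show ?thesis by (simp add: algebra_simps)
    qed
    ultimately show "\<exists>y. ((\<lambda>x. F x * exp (c * x)) has_real_derivative y) (at x) \<and> y \<le> 0"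
      by blast
  qed
  then have "F b * exp (c * b) * exp (- c * b) \<le> F a * exp (c * a) * exp (- c * b)"
    by (intro mult_right_mono) auto
  then have "F b \<le> F a * exp (- c * (b - a))"
    by (simp add: mult.assoc exp_add[symmetric] algebra_simps)
  then show ?thesis by (simp add: F_def c_def)
qed

section \<open>The binomial tail when the mean equals the threshold\<close>

text \<open>
  Up to a constant, \<open>- x F'(x) = x ^ k (1 - x) ^ (r - k)\<close>; this compares the weight at the two points
  that are symmetric about \<open>a = k / r\<close> on the logarithmic scale.
\<close>

lemma reflected_beta_weight_le:
  fixes a t :: real
  assumes "0 < a" "a < 1" "1 \<le> t" "a * t < 1" and k: "real k = real r * a"
  shows "(a * t) ^ k * (1 - a * t) ^ (r - k) \<le> (a / t) ^ k * (1 - a / t) ^ (r - k)"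
proof -
  \<comment> \<open>The logarithm of the quotient of the weights at \<open>a * u\<close> and
    \<open>a / u\<close>; it vanishes at \<open>u = 1\<close>.\<close>
  define f where "f u = 2 * real k * ln u + real (r - k) * (ln (1 - a * u) - ln (1 - a / u))" for u
  have "real r * a \<le> real r" using assms by (simp add: mult_left_le)
  then have rk: "real (r - k) = real r * (1 - a)"
    using k by (auto simp: of_nat_diff algebra_simps)
  have at: "a / t < 1" using assms by (simp add: field_simps)
  have "f t \<le> f 1"
  proof (rule DERIV_nonpos_imp_nonincreasing[OF \<open>1 \<le> t\<close>])
    fix u assume u: "1 \<le> u" "u \<le> t"
    have pos: "0 < u" "0 < 1 - a * u" "0 < u - a" "0 < 1 - a / u" "0 < 1 - a"
      using u assms order_le_less_trans[OF mult_left_mono[OF u(2), of a]] by auto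
    let ?D = "2 * real k / u + real (r - k) * (- a / (1 - a * u) - (a / u^2) / (1 - a / u))"
    have "(f has_real_derivative ?D) (at u)"
    proof -
      have "((\<lambda>u. ln (1 - a * u)) has_real_derivative - a / (1 - a * u)) (at u)"
        using pos by (auto intro!: derivative_eq_intros)
      moreover have "((\<lambda>u. ln (1 - a / u)) has_real_derivative (a / u^2) / (1 - a / u)) (at u)"
        using pos(1,4) by (auto intro!: derivative_eq_intros simp: power2_eq_square simp del: diff_gt_0_iff_gt)
      moreover have "((\<lambda>u. 2 * real k * ln u) has_real_derivative 2 * real k / u) (at u)"
        using pos by (auto intro!: derivative_eq_intros)
      ultimately show ?thesis
        unfolding f_def by (intro DERIV_add DERIV_cmult DERIV_diff)
    qed
    moreover have "?D \<le> 0"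
    proof -
      have "(a / u^2) / (1 - a / u) = a / u * (1 / (u - a))"
        using pos by (simp add: field_simps power2_eq_square)
      then have D: "?D = real r * a * (1 - a) / u * (2 / (1 - a) - (u / (1 - a * u) + 1 / (u - a)))"
      proof -
        have "2 * (real r * a) / u + real r * (1 - a) * (- (a * A) - a / u * B)
            = real r * a * (1 - a) / u * (2 / (1 - a) - (u * A + B))" for A B
          using pos(1,5) by (simp add: field_simps)
        from this[of "1 / (1 - a * u)" "1 / (u - a)"] show ?thesis
          unfolding k rk \<open>(a / u^2) / (1 - a / u) = _\<close> by simp
      qed
      \<comment> \<open>The difference vanishes to second order at \<open>u = 1\<close>, and its
        numerator is a multiple of a square, so the sign is settled for all
        \<open>u\<close>.\<close>
      have "u / (1 - a * u) + 1 / (u - a) - 2 / (1 - a)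
          = (1 + a) * (u - 1)^2 / ((1 - a * u) * (u - a) * (1 - a))"
        using pos by (simp add: divide_simps) (simp add: algebra_simps power2_eq_square)
      moreover have "\<dots> \<ge> 0" using pos assms by simp
      ultimately have "2 / (1 - a) - (u / (1 - a * u) + 1 / (u - a)) \<le> 0" by simp
      then show ?thesis
        unfolding D using pos assms by (intro mult_nonneg_nonpos) auto
    qed
    ultimately show "\<exists>y. (f has_real_derivative y) (at u) \<and> y \<le> 0" by blast
  qed
  then have "f t \<le> 0" by (simp add: f_def)
  then have "ln ((a * t) ^ k * (1 - a * t) ^ (r - k)) \<le> ln ((a / t) ^ k * (1 - a / t) ^ (r - k))"
    using assms at by (simp add: f_def ln_mult ln_div ln_realpow algebra_simps)
  then show ?thesis
    using assms at by (subst (asm) ln_le_cancel_iff) auto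
qed

lemma sum_Bernstein_le_1:
  assumes "0 \<le> x" "x \<le> 1" "k \<le> Suc r"
  shows "(\<Sum>j<k. Bernstein r j x) \<le> 1"
proof -
  have "(\<Sum>j<k. Bernstein r j x) \<le> (\<Sum>j\<le>r. Bernstein r j x)"
    using assms by (intro sum_mono2) (auto simp: Bernstein_nonneg)
  then show ?thesis by simp
qed

lemma sum_Bernstein_at_1: "k \<le> r \<Longrightarrow> (\<Sum>j<k. Bernstein r j 1) = 0"
  by (intro sum.neutral) (auto simp: Bernstein_def)

text \<open>One half of the fact that an integer mean of a binomial law is a median.\<close>

lemma sum_Bernstein_mean_le_half:
  assumes "0 < k" "k \<le> r"
  shows "(\<Sum>j<k. Bernstein r j (real k / real r)) \<le> 1/2"
proof (cases "k = r")
  case True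
  then show ?thesis using assms by (simp add: sum_Bernstein_at_1)
next
  case False
  define a where "a = real k / real r"
  define F where "F x = (\<Sum>j<k. Bernstein r j x)" for x
  have a: "0 < a" "a < 1" "real k = real r * a"
    using assms False by (auto simp: a_def)
  obtain l m where kl: "k = Suc l" and rm: "r = Suc m"
    using assms by (metis Suc_le_D gr0_implies_Suc)
  have F': "(F has_real_derivative - real r * Bernstein m l x) (at x)" for x
    unfolding F_def kl rm lessThan_Suc_atMost by (rule has_real_derivative_sum_Bernstein)
  define h where "h t = F (a * t) + F (a / t)" for t
  have h': "(h has_real_derivative
      (- real r * Bernstein m l (a * t)) * a + (- real r * Bernstein m l (a / t)) * (- a / t^2)) (at t)"
    if "1 \<le> t" for t
    unfolding h_def using that
    by (intro DERIV_add DERIV_chain2[OF F']) (auto intro!: derivative_eq_intros simp: power2_eq_square)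
  have "h 1 \<le> h (1 / a)"
  proof (rule DERIV_nonneg_imp_increasing_open[where f = h])
    fix t assume t: "1 < t" "t < 1 / a"
    let ?D = "(- real r * Bernstein m l (a * t)) * a + (- real r * Bernstein m l (a / t)) * (- a / t^2)"
    let ?w = "\<lambda>x. x ^ k * (1 - x) ^ (r - k)"
    \<comment> \<open>The left side is \<open>- x * F' x\<close>, so \<open>t * ?D\<close> is, up to
      a nonnegative constant, the difference of the weights at \<open>a / t\<close> and
      \<open>a * t\<close>.\<close>
    have eq: "real r * (x * Bernstein m l x) = real k * real (r choose k) * ?w x" for x
      using Bernstein_absorb[of x m l] unfolding Bernstein_def[of "Suc m"] kl rm by (simp add: mult_ac)
    have "?w (a * t) \<le> ?w (a / t)"
      using a t by (intro reflected_beta_weight_le) (auto simp: field_simps)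
    then have "real k * real (r choose k) * ?w (a * t) \<le> real k * real (r choose k) * ?w (a / t)"
      by (intro mult_left_mono) auto
    then have "real r * (a / t * Bernstein m l (a / t)) - real r * (a * t * Bernstein m l (a * t)) \<ge> 0"
      unfolding eq by simp
    moreover have "t * ?D = real r * (a / t * Bernstein m l (a / t)) - real r * (a * t * Bernstein m l (a * t))"
      using t by (simp add: field_simps power2_eq_square)
    ultimately have "0 \<le> t * ?D" by linarith
    moreover have "0 < t" using t by simp
    ultimately have "0 \<le> ?D" by (rule mult_left_le_imp_le[of t 0, simplified mult_zero_right])
    moreover have "(h has_real_derivative ?D) (at t)" using h' t by simp
    ultimately show "\<exists>y. (h has_real_derivative y) (at t) \<and> 0 \<le> y" by blast
  next
    show "continuous_on {1..1 / a} h"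
      by (intro continuous_at_imp_continuous_on ballI) (auto intro: DERIV_isCont[OF h'])
  qed (use a in simp)
  \<comment> \<open>At \<open>t = 1 / a\<close> the two points are \<open>1\<close> and
    \<open>a^2\<close>.\<close>
  moreover have "F 1 = 0" unfolding F_def using assms by (simp add: sum_Bernstein_at_1)
  moreover have "F (a / (1 / a)) \<le> 1"
    unfolding F_def using a assms by (intro sum_Bernstein_le_1) (auto simp: mult_le_one)
  ultimately have "2 * F a \<le> 1" using a by (simp add: h_def)
  then show ?thesis by (simp add: F_def a_def)
qed

section \<open>The claimed bound as a function of \<gamma>\<close>

definition tail_bound :: "real \<Rightarrow> real" where
  "tail_bound \<gamma> = exp (- \<gamma>) * (exp 1 / 2) powr exp (1 - \<gamma>)"

lemma tail_bound_eq_exp: "tail_bound \<gamma> = exp (- \<gamma> + (1 - ln 2) * exp (1 - \<gamma>))"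
  by (simp only: tail_bound_def powr_def exp_add) (simp add: ln_div mult.commute)

lemma ln_2_less_1: "ln 2 < (1::real)"
  using ln_less_self[of 2] ln_add_one_self_less_self[of 1] by simp

lemma tail_bound_antimono: "x \<le> y \<Longrightarrow> tail_bound y \<le> tail_bound x"
  unfolding tail_bound_eq_exp exp_le_cancel_iff
  using ln_2_less_1 by (intro add_mono mult_left_mono) auto

lemma exp_le_tail_bound: "exp (- \<gamma>) \<le> tail_bound \<gamma>"
  unfolding tail_bound_eq_exp using ln_2_less_1 by simp

text \<open>Both sides are 1/2 at \<open>\<gamma> = 1\<close>. With \<open>d = \<gamma> - 1\<close>,
  comparing exponents leaves \<open>(1 - ln 2) * (1 - exp (- d)) \<le> d / 3\<close>.\<close>

lemma half_exp_le_tail_bound: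
  assumes "1 \<le> \<gamma>"
  shows "1/2 * exp (- (4/3) * (\<gamma> - 1)) \<le> tail_bound \<gamma>"
proof -
  define d where "d = \<gamma> - 1"
  have "1 - exp (- d) \<le> d" using exp_ge_add_one_self[of "- d"] by simp
  moreover have "0 \<le> d" "0 \<le> 1 - ln (2::real)" "1 - ln 2 \<le> (1/3::real)"
    using assms ln_2_less_1 ln2_ge_two_thirds by (auto simp: d_def)
  ultimately have "(1 - ln 2) * (1 - exp (- d)) \<le> 1/3 * d"
    by (smt (verit) mult_left_mono mult_right_mono)
  then have "- ln 2 - 4/3 * d \<le> - \<gamma> + (1 - ln 2) * exp (1 - \<gamma>)"
    by (simp add: d_def field_simps)
  then have "exp (- ln 2 + - (4/3) * d) \<le> tail_bound \<gamma>"
    unfolding tail_bound_eq_exp by simp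
  then show ?thesis unfolding exp_add d_def[symmetric] by (simp add: exp_minus)
qed

lemma binomial_tail_le:
  assumes k: "0 < k" "real k \<le> real r * a" and a: "0 \<le> a" "a \<le> 1"
  shows "(\<Sum>j<k. Bernstein r j a) \<le> tail_bound (real r * a / real k)"
proof (cases "k = 1")
  case True
  have "(1 - a) ^ r \<le> exp (- a) ^ r"
    using a exp_ge_add_one_self[of "- a"] by (intro power_mono) auto
  also have "\<dots> = exp (- (real r * a))" by (simp add: exp_of_nat_mult[symmetric])
  finally show ?thesis
    using True exp_le_tail_bound[of "real r * a"] by (simp add: Bernstein_def)
next
  case False
  have "real r * a \<le> real r" using a by (simp add: mult_left_le)
  then have kr: "k \<le> r" using k by linarith
  \<comment> \<open>The success probability with mean exactly \<open>k\<close>: the tail is at most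
    1/2 there and decays from there to \<open>a\<close>.\<close>
  define c where "c = real k / real r"
  have c: "real k = real r * c" "0 \<le> c" "c \<le> a"
    using k kr by (auto simp: c_def field_simps)
  have "(\<Sum>j<k. Bernstein r j a) \<le> (\<Sum>j<k. Bernstein r j c) * exp (- (4/3) * (real r / real k) * (a - c))"
    using False k a c by (intro sum_Bernstein_exp_decay) auto
  also have "\<dots> \<le> 1/2 * exp (- (4/3) * (real r / real k) * (a - c))"
    unfolding c_def using sum_Bernstein_mean_le_half[OF k(1) kr] by (intro mult_right_mono) auto
  also have "- (4/3) * (real r / real k) * (a - c) = - (4/3) * (real r * a / real k - 1)"
    using k kr by (simp add: c_def field_simps)
  also have "1/2 * exp \<dots> \<le> tail_bound (real r * a / real k)"
    using k by (intro half_exp_le_tail_bound) (simp add: field_simps)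
  finally show ?thesis .
qed

subsection \<open>Reduction to equal success probabilities\<close>

text \<open>On a probability generating polynomial this is the probability of a value below
  \<open>k\<close>. Arbitrary polynomials are allowed so that signed differences can be treated
  linearly.\<close>

definition coeff_sum :: "real poly \<Rightarrow> nat \<Rightarrow> real" where
  "coeff_sum Q k = (\<Sum>j<k. coeff Q j)"

lemma coeff_sum_add: "coeff_sum (P + Q) k = coeff_sum P k + coeff_sum Q k"
  by (simp add: coeff_sum_def sum.distrib)

lemma coeff_sum_smult: "coeff_sum (smult c Q) k = c * coeff_sum Q k"
  by (simp add: coeff_sum_def sum_distrib_left)

text \<open>At \<open>k = 0\<close> truncated subtraction is harmless, as both sums are
  empty.\<close>

lemma coeff_sum_pCons_0: "coeff_sum (pCons 0 Q) k = coeff_sum Q (k - 1)"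
  by (cases k) (simp_all add: coeff_sum_def sum.lessThan_Suc_shift del: sum.lessThan_Suc)

lemma coeff_sum_bernoulli_mult:
  "coeff_sum ([:1 - q, q:] * Q) k = (1 - q) * coeff_sum Q k + q * coeff_sum Q (k - 1)"
  by (simp add: coeff_sum_add coeff_sum_smult coeff_sum_pCons_0)

text \<open>A multiset suits the exchange argument, which replaces and drops members regardless of
  order.\<close>

definition bernoulli_pgf :: "real multiset \<Rightarrow> real poly" where
  "bernoulli_pgf N = (\<Prod>q\<in>#N. [:1 - q, q:])"

lemma bernoulli_pgf_union: "bernoulli_pgf (K + N) = bernoulli_pgf K * bernoulli_pgf N"
  by (simp add: bernoulli_pgf_def)

text \<open>The product of the two linear factors is a polynomial depending only on
  \<open>x + y\<close>, plus \<open>x * y\<close> times \<open>(1 - T)^2\<close> in the variable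
  \<open>T\<close>.\<close>

lemma coeff_sum_bernoulli_pair:
  "coeff_sum (bernoulli_pgf {#x, y#} * Q) k
    = coeff_sum ([:1 - (x + y), x + y:] * Q) k + x * y * coeff_sum ([:1, -2, 1:] * Q) k"
proof -
  have "bernoulli_pgf {#x, y#} * Q
      = [:1 - (x + y), x + y:] * Q + smult (x * y) ([:1, -2, 1:] * Q)"
    unfolding bernoulli_pgf_def mult_smult_left[symmetric] distrib_right[symmetric]
    by (simp add: algebra_simps)
  then show ?thesis by (simp only: coeff_sum_add coeff_sum_smult)
qed

lemma coeff_sum_bernoulli_replicate:
  assumes "k \<le> Suc r"
  shows "coeff_sum (bernoulli_pgf (replicate_mset r a)) k = (\<Sum>j<k. Bernstein r j a)"
  using assms by (simp add: coeff_sum_def bernoulli_pgf_def Bernstein_def coeff_linear_poly_power)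

section \<open>The exchange argument\<close>

lemma tail_bound_nonneg: "0 \<le> tail_bound \<gamma>"
  by (simp add: tail_bound_def)

lemma sum_mset_le_const:
  fixes a :: real
  shows "(\<And>x. x \<in># N \<Longrightarrow> x \<le> a) \<Longrightarrow> sum_mset N \<le> real (size N) * a"
  by (induction N) (auto simp: algebra_simps intro!: add_mono)

lemma const_le_sum_mset:
  fixes a :: real
  shows "(\<And>x. x \<in># N \<Longrightarrow> a \<le> x) \<Longrightarrow> real (size N) * a \<le> sum_mset N"
  by (induction N) (auto simp: algebra_simps intro!: add_mono)

text \<open>If all members lay on one side of the mean, the deviating \<open>z\<close> would push
  the sum strictly off \<open>size N * a\<close>.\<close>

lemma obtain_around_mean:
  fixes N :: "real multiset"
  assumes a: "a = sum_mset N / real (size N)" and "z \<in># N" "z \<noteq> a"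
  obtains x y L where "N = {#x, y#} + L" "x < a" "a < y"
proof -
  have mean: "sum_mset N = real (size N) * a"
    using assms by auto
  obtain R where R: "N = add_mset z R" using assms by (metis multi_member_split)
  have "\<exists>x. x \<in># N \<and> x < a"
  proof (rule ccontr)
    assume *: "\<not> ?thesis"
    then have ge: "a \<le> x" if "x \<in># N" for x using that by (meson not_less)
    have "real (size R) * a \<le> sum_mset R"
      using ge R by (intro const_le_sum_mset) simp
    moreover have "a < z" using ge \<open>z \<noteq> a\<close> \<open>z \<in># N\<close> by (simp add: less_le)
    ultimately show False using mean R by (simp add: algebra_simps)
  qed
  moreover have "\<exists>y. y \<in># N \<and> a < y"
  proof (rule ccontr)
    assume *: "\<not> ?thesis"
    then have le: "x \<le> a" if "x \<in># N" for x using that by (meson not_less)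
    have "sum_mset R \<le> real (size R) * a"
      using le R by (intro sum_mset_le_const) simp
    moreover have "z < a" using le \<open>z \<noteq> a\<close> \<open>z \<in># N\<close> by (simp add: less_le)
    ultimately show False using mean R by (simp add: algebra_simps)
  qed
  ultimately obtain x y where xy: "x \<in># N" "x < a" "y \<in># N" "a < y" by blast
  obtain R where R: "N = add_mset x R" using xy by (metis multi_member_split)
  then have "y \<in># R" using xy by auto
  then obtain L where "R = add_mset y L" by (metis multi_member_split)
  with R xy show ?thesis by (intro that[of x y L]) auto
qed

text \<open>The induction is lexicographic: first the number of members, then how many of them
  differ from the mean.\<close>

lemma bernoulli_pgf_tail_le:
  assumes "\<And>q. q \<in># N \<Longrightarrow> 0 \<le> q \<and> q \<le> 1" "0 < k" "real k \<le> sum_mset N"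
  shows "coeff_sum (bernoulli_pgf N) k \<le> tail_bound (sum_mset N / real k)"
  using assms
proof (induction N arbitrary: k rule: wf_induct_rule[OF wf_measures, of
    "[size, \<lambda>N. size {#q \<in># N. q \<noteq> sum_mset N / real (size N)#}]", case_names step])
  case (step N)
  define a where "a = sum_mset N / real (size N)"
  have N0: "N \<noteq> {#}" using step.prems by auto
  show ?case
  proof (cases "\<forall>q \<in># N. q = a")
    case True
    then have rep: "N = replicate_mset (size N) a"
      by (metis multiset_eqI set_mset_subset_singletonD singletonI subsetI)
    define r where "r = size N"
    have sum: "sum_mset N = real r * a" using N0 by (simp add: a_def r_def)
    have a: "0 \<le> a" "a \<le> 1" using step.prems True N0 by (metis multiset_nonemptyE)+
    have "real r * a \<le> real r" using a by (simp add: mult_left_le)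
    then have kr: "k \<le> Suc r" using step.prems sum by linarith
    show ?thesis
      using binomial_tail_le[of k r a] step.prems a coeff_sum_bernoulli_replicate[OF kr] rep sum r_def
      by metis
  next
    case False
    then obtain x y L where N: "N = {#x, y#} + L" and xy: "x < a" "a < y"
      using obtain_around_mean[OF a_def] by metis
    have x01: "0 \<le> x" "y \<le> 1" using step.prems(1) by (auto simp: N)
    have L01: "0 \<le> q \<and> q \<le> 1" if "q \<in># L" for q
      using step.prems(1)[of q] that by (simp add: N)
    \<comment> \<open>The slope of the tail in the product of the pair; its sign decides the
      exchange.\<close>
    define D where "D = coeff_sum ([:1, -2, 1:] * bernoulli_pgf L) k"
    have exchange: "coeff_sum (bernoulli_pgf N) k \<le> coeff_sum (bernoulli_pgf ({#x', y'#} + L)) k"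
      if "x' + y' = x + y" "x * y * D \<le> x' * y' * D" for x' y'
      using that coeff_sum_bernoulli_pair[of x y "bernoulli_pgf L" k]
        coeff_sum_bernoulli_pair[of x' y' "bernoulli_pgf L" k]
      unfolding N D_def by (simp only: bernoulli_pgf_union)
    consider "0 \<le> D" | "D < 0" "x + y \<le> 1" | "D < 0" "1 < x + y" by linarith
    then show ?thesis
    proof cases
      case 1
      \<comment> \<open>The product grows by \<open>(a - x) * (y - a)\<close>. Sum and size stay,
        and fewer members differ from the mean.\<close>
      define N' where "N' = {#a, x + y - a#} + L"
      have "0 \<le> (a - x) * (y - a)" using xy by simp
      then have "x * y * D \<le> a * (x + y - a) * D"
        using 1 by (intro mult_right_mono) (auto simp: algebra_simps)
      then have "coeff_sum (bernoulli_pgf N) k \<le> coeff_sum (bernoulli_pgf N') k"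
        unfolding N'_def by (intro exchange) auto
      moreover have same: "sum_mset N' = sum_mset N" "size N' = size N"
        by (auto simp: N'_def N)
      moreover have "coeff_sum (bernoulli_pgf N') k \<le> tail_bound (sum_mset N' / real k)"
      proof (rule step.IH)
        have "size {#q \<in># N'. q \<noteq> a#} < size {#q \<in># N. q \<noteq> a#}"
          using xy by (simp add: N'_def N)
        then show "(N', N) \<in> measures [size, \<lambda>N. size {#q \<in># N. q \<noteq> sum_mset N / real (size N)#}]"
          by (simp add: same a_def)
        show "0 \<le> q \<and> q \<le> 1" if "q \<in># N'" for q
          using that L01[of q] xy x01 by (auto simp: N'_def)
      qed (use step.prems(2,3) same in auto)
      ultimately show ?thesis by simp
    next
      case 2
      \<comment> \<open>The smallest product for the given sum is 0; the member 0 contributes the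
        factor 1 and disappears.\<close>
      define N' where "N' = add_mset (x + y) L"
      have "coeff_sum (bernoulli_pgf N) k \<le> coeff_sum (bernoulli_pgf ({#0, x + y#} + L)) k"
        using 2 xy x01 by (intro exchange) (auto intro!: mult_nonneg_nonpos)
      also have "bernoulli_pgf ({#0, x + y#} + L) = bernoulli_pgf N'"
        by (simp add: bernoulli_pgf_def N'_def)
      also have "coeff_sum (bernoulli_pgf N') k \<le> tail_bound (sum_mset N' / real k)"
      proof (rule step.IH)
        show "0 \<le> q \<and> q \<le> 1" if "q \<in># N'" for q
          using that L01[of q] xy x01 2 by (auto simp: N'_def)
      qed (use step.prems(2,3) in \<open>auto simp: N'_def N\<close>)
      finally show ?thesis by (simp add: N'_def N add.assoc)
    next
      case 3
      \<comment> \<open>Here the smallest product within the unit interval is at the pair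
        \<open>1, x + y - 1\<close>; the member 1 contributes a shift, which lowers \<open>k\<close>
        by one.\<close>
      define N' where "N' = add_mset (x + y - 1) L"
      have "0 \<le> (1 - x) * (1 - y)" using xy x01 by simp
      then have "x + y - 1 \<le> x * y" by (simp add: algebra_simps)
      then have "coeff_sum (bernoulli_pgf N) k \<le> coeff_sum (bernoulli_pgf ({#1, x + y - 1#} + L)) k"
        using 3 by (intro exchange) (auto intro!: mult_right_mono_neg)
      also have "bernoulli_pgf ({#1, x + y - 1#} + L) = pCons 0 (bernoulli_pgf N')"
        by (simp add: bernoulli_pgf_def N'_def)
      finally have le: "coeff_sum (bernoulli_pgf N) k \<le> coeff_sum (bernoulli_pgf N') (k - 1)"
        by (simp add: coeff_sum_pCons_0)
      show ?thesis
      proof (cases "k = 1")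
        case True
        then show ?thesis
          using le tail_bound_nonneg[of "sum_mset N / real k"] by (simp add: coeff_sum_def)
      next
        case False
        have sum: "sum_mset N' = sum_mset N - 1" by (simp add: N'_def N)
        note le
        also have "coeff_sum (bernoulli_pgf N') (k - 1) \<le> tail_bound (sum_mset N' / real (k - 1))"
        proof (rule step.IH)
          show "0 \<le> q \<and> q \<le> 1" if "q \<in># N'" for q
            using that L01[of q] xy x01 3 by (auto simp: N'_def)
        qed (use False step.prems(2,3) sum in \<open>auto simp: N'_def N\<close>)
        also have "\<dots> \<le> tail_bound (sum_mset N / real k)"
        \<comment> \<open>A quotient that is at least 1 does not decrease when numerator and
          denominator both drop by 1.\<close>
        proof (rule tail_bound_antimono)
          have "1 < k" using False step.prems by simp
          then show "sum_mset N / real k \<le> sum_mset N' / real (k - 1)"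
            using step.prems(2,3) by (simp add: sum field_simps)
        qed
        finally show ?thesis .
      qed
    qed
  qed
qed

subsection \<open>Sums of independent Bernoulli variables\<close>

context prob_space
begin

text \<open>Only the law of \<open>X\<close> is prescribed, so other values may occur on a null set
  and everything is transported through \<open>distr\<close>.\<close>

lemma bernoulli_rv_prob:
  assumes "bernoulli_rv M X q"
  shows "AE \<omega> in M. X \<omega> = 0 \<or> X \<omega> = 1"
    and "prob {\<omega> \<in> space M. X \<omega> = 1} = q"
    and "prob {\<omega> \<in> space M. X \<omega> = 0} = 1 - q"
    and "expectation X = q" and "integrable M X"
proof -
  let ?B = "measure_pmf (bernoulli_pmf q)"
  have q: "0 \<le> q" "q \<le> 1" and X[measurable]: "X \<in> borel_measurable M"
    and d: "distr M borel X = distr ?B borel (of_bool :: bool \<Rightarrow> real)"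
    using assms by (auto simp: bernoulli_rv_def)
  have "AE x in distr M borel X. x = 0 \<or> x = 1"
    unfolding d by (subst AE_distr_iff) auto
  then show "AE \<omega> in M. X \<omega> = 0 \<or> X \<omega> = 1"
    by (subst (asm) AE_distr_iff) auto
  have pr: "prob {\<omega> \<in> space M. X \<omega> = c} = measure ?B {b. of_bool b = c}" for c
  proof -
    have "prob {\<omega> \<in> space M. X \<omega> = c} = measure (distr M borel X) {c}"
      by (subst measure_distr) (auto intro!: arg_cong[where f = prob])
    also have "\<dots> = measure ?B {b. of_bool b = c}"
      unfolding d by (subst measure_distr) (auto intro!: arg_cong[where f = "measure ?B"])
    finally show ?thesis .
  qed
  have "{b. of_bool b = (1::real)} = {True}" "{b. of_bool b = (0::real)} = {False}" by auto
  then show "prob {\<omega> \<in> space M. X \<omega> = 1} = q" "prob {\<omega> \<in> space M. X \<omega> = 0} = 1 - q"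
    using q by (simp_all add: pr measure_pmf_single)
  have "expectation X = (\<integral>x. x \<partial>distr M borel X)" by (simp add: integral_distr)
  also have "\<dots> = (\<integral>b. of_bool b \<partial>?B)" unfolding d by (simp add: integral_distr)
  also have "\<dots> = q" using q by simp
  finally show "expectation X = q" .
  have "integrable ?B (of_bool :: bool \<Rightarrow> real)"
    by (rule integrable_measure_pmf_finite) simp
  then have "integrable (distr M borel X) (\<lambda>x. x)"
    unfolding d by (simp add: integrable_distr_eq)
  then show "integrable M X" by (simp add: integrable_distr_eq)
qed

text \<open>Conditioning on the last variable lowers the threshold by 0 or 1. An integer
  \<open>z\<close> lets it go below zero, where \<open>nat\<close> matches the truncated subtraction
  in \<open>coeff_sum_bernoulli_mult\<close>.\<close>

lemma prob_sum_bernoulli_less: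
  fixes z :: int and m n :: nat
  assumes bern: "\<And>i. i < n \<Longrightarrow> bernoulli_rv M (X i) (p i)"
    and indep: "indep_vars (\<lambda>_. borel) X {..<n}"
    and "m \<le> n"
  shows "prob {\<omega> \<in> space M. (\<Sum>i<m. X i \<omega>) < of_int z}
    = coeff_sum (\<Prod>i<m. [:1 - p i, p i:]) (nat z)"
  using \<open>m \<le> n\<close>
proof (induction m arbitrary: z)
  case 0
  have "coeff_sum 1 j = of_bool (0 < j)" for j
    by (cases j) (simp_all add: coeff_sum_def sum.lessThan_Suc_shift del: sum.lessThan_Suc)
  then show ?case by (simp add: prob_space)
next
  case (Suc m)
  have nat_diff_1: "nat (z - 1) = nat z - 1" by simp
  have meas[measurable]: "X i \<in> borel_measurable M" if "i < n" for i
    using bern[OF that] by (simp add: bernoulli_rv_def)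
  define T where "T \<omega> = (\<Sum>i<m. X i \<omega>)" for \<omega>
  have [measurable]: "T \<in> borel_measurable M" "X m \<in> borel_measurable M"
    unfolding T_def using Suc.prems by auto
  have "indep_vars (\<lambda>_. borel) X (insert m {..<m})"
    by (rule indep_vars_subset[OF indep]) (use Suc.prems in auto)
  then have ind: "indep_var borel (X m) borel T"
    unfolding T_def by (intro indep_vars_sum) auto
  note B = bernoulli_rv_prob[OF bern, of m]
  have joint: "prob {\<omega> \<in> space M. X m \<omega> = c \<and> T \<omega> < u}
      = prob {\<omega> \<in> space M. X m \<omega> = c} * prob {\<omega> \<in> space M. T \<omega> < u}" for c u :: real
  proof -
    have "prob ((\<lambda>x. (X m x, T x)) -` ({c} \<times> {..<u}) \<inter> space M)
        = prob (X m -` {c} \<inter> space M) * prob (T -` {..<u} \<inter> space M)"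
      by (rule indep_varD[OF ind]) auto
    also have "(\<lambda>x. (X m x, T x)) -` ({c} \<times> {..<u}) \<inter> space M = {\<omega> \<in> space M. X m \<omega> = c \<and> T \<omega> < u}"
      by auto
    also have "X m -` {c} \<inter> space M = {\<omega> \<in> space M. X m \<omega> = c}" by auto
    also have "T -` {..<u} \<inter> space M = {\<omega> \<in> space M. T \<omega> < u}" by auto
    finally show ?thesis .
  qed
  \<comment> \<open>The two events agree only almost everywhere, since \<open>X m\<close> is 0 or 1
    only up to a null set.\<close>
  have "prob {\<omega> \<in> space M. (\<Sum>i<Suc m. X i \<omega>) < of_int z}
      = prob ({\<omega> \<in> space M. X m \<omega> = 0 \<and> T \<omega> < of_int z} \<union> {\<omega> \<in> space M. X m \<omega> = 1 \<and> T \<omega> < of_int (z - 1)})"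
    using B(1) Suc.prems
    by (intro measure_eq_AE) (auto simp: T_def[symmetric] elim!: eventually_mono)
  also have "\<dots> = prob {\<omega> \<in> space M. X m \<omega> = 0 \<and> T \<omega> < of_int z}
      + prob {\<omega> \<in> space M. X m \<omega> = 1 \<and> T \<omega> < of_int (z - 1)}"
    by (intro finite_measure_Union) auto
  also have "\<dots> = (1 - p m) * prob {\<omega> \<in> space M. T \<omega> < of_int z}
      + p m * prob {\<omega> \<in> space M. T \<omega> < of_int (z - 1)}"
    unfolding joint using B Suc.prems by simp
  also have "\<dots> = coeff_sum (\<Prod>i<Suc m. [:1 - p i, p i:]) (nat z)"
    using Suc.IH[of z] Suc.IH[of "z - 1"] Suc.prems
      coeff_sum_bernoulli_mult[of "p m" "\<Prod>i<m. [:1 - p i, p i:]" "nat z"]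
    unfolding T_def by (simp add: mult.commute nat_diff_1 del: mult_pCons_left mult_pCons_right)
  finally show ?case .
qed

end

theorem theorem5:
  fixes M :: "'a measure" and X :: "nat \<Rightarrow> 'a \<Rightarrow> real" and p :: "nat \<Rightarrow> real"
    and n k :: nat and S :: "'a \<Rightarrow> real" and \<gamma> :: real
  assumes prob: "prob_space M"
    and bern: "\<And>i. i < n \<Longrightarrow> bernoulli_rv M (X i) (p i)"
    and indep: "prob_space.indep_vars M (\<lambda>_. borel) X {..<n}"
  defines "S \<equiv> \<lambda>\<omega>. \<Sum>i<n. X i \<omega>"
  assumes k_pos: "0 < k"
    and k_le: "real k \<le> prob_space.expectation M S"
  defines "\<gamma> \<equiv> prob_space.expectation M S / real k"
  shows "measure M {\<omega> \<in> space M. S \<omega> < real k}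
           \<le> exp (- \<gamma>) * (exp 1 / 2) powr exp (1 - \<gamma>)"
proof -
  interpret prob_space M by (rule prob)
  \<comment> \<open>The image multiset keeps repeated values of \<open>p\<close>.\<close>
  define N where "N = image_mset p (mset_set {..<n})"
  have "expectation S = (\<Sum>i<n. expectation (X i))"
    unfolding S_def using bernoulli_rv_prob(5)[OF bern] by (intro Bochner_Integration.integral_sum) auto
  also have "\<dots> = sum_mset N"
    unfolding N_def sum_unfold_sum_mset[symmetric]
    by (rule sum.cong) (auto simp: bernoulli_rv_prob(4)[OF bern])
  finally have ES: "expectation S = sum_mset N" .
  have "bernoulli_pgf N = (\<Prod>i<n. [:1 - p i, p i:])"
    by (simp add: bernoulli_pgf_def N_def prod_unfold_prod_mset image_mset.compositionality comp_def)
  then have "prob {\<omega> \<in> space M. S \<omega> < real k} = coeff_sum (bernoulli_pgf N) k"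
    using prob_sum_bernoulli_less[OF bern indep order_refl, of "int k"] by (simp add: S_def)
  also have "\<dots> \<le> tail_bound (sum_mset N / real k)"
    using k_pos k_le bern unfolding ES
    by (intro bernoulli_pgf_tail_le) (auto simp: N_def bernoulli_rv_def)
  finally show ?thesis by (simp add: \<gamma>_def ES tail_bound_def)
qed

end
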